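(* Let $n, m, D$ be positive integers and let $\Omega=(a_1,\ldots,a_m)$ be a dataset of points $a_i\in[0,1]^n$. Let $\Theta_D$ be the set of real polynomials in $n$ variables of degree at most $D$ whose coefficient vector has Euclidean norm $1$, equipped with the likelihood $p(x\mid f)=\frac{1}{r(f)}e^{-f(x)^2}$ for $x\in[0,1]^n$, the prior $p(f)=\frac{1}{\beta}r(f)$, and the resulting posterior objective $$p(f\mid\Omega)=\frac{1}{\kappa}\prod_{i=1}^m p(a_i\mid f)\,p(f)^m ,\qquad f\in\Theta_D ,$$ where $r(f)$, $\beta$ and $\kappa$ are as in the context. Let $U$ be the $m\times N$ multivariate Vandermonde matrix of $\Omega$, let $\lambda$ be the smallest eigenvalue of $U^{t}U$, and let $E_\lambda\subset\mathbb{R}^N$ be the corresponding eigenspace. Then the Maximum A Posteriori problem $$\operatorname*{arg\,max}_{f\in\Theta_D}\; p(f\mid\Omega)$$ is equivalent to $$\operatorname*{arg\,min}_{f\in\Theta_D}\;\sum_{i=1}^m f(a_i)^2 ,\qquad\text{that is, to}\qquad \operatorname*{arg\,min}_{c\in\mathbb{S}^{N-1}}\; c^{t}\,U^{t}U\,c ,$$ and its solutions are exactly the polynomials $f=F(c)$ whose coefficient vector $c$ is an element of $E_\lambda$ of Euclidean norm $1$.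
   Context: Let $N=\binom{n+D}{D}$ and fix an ordering $x^{\alpha_1},\ldots,x^{\alpha_N}$ of all monomials in $x_1,\ldots,x_n$ of degree at most $D$ (with $x^{\alpha_N}=1$). The linear isomorphism $F:\mathbb{R}^N\to\{f\in\mathbb{R}[x_1,\ldots,x_n] : \deg f\le D\}$ sends $c=(c_1,\ldots,c_N)$ to $\sum_{k=1}^N c_k x^{\alpha_k}$. Set $\Theta_D=\{f\in\mathbb{R}[x_1,\ldots,x_n] : \deg(f)\le D,\ \|F^{-1}(f)\|=1\}$, where $\|\cdot\|$ is the Euclidean norm; thus $F$ restricts to a bijection from the unit sphere $\mathbb{S}^{N-1}\subset\mathbb{R}^N$ onto $\Theta_D$. The multivariate Vandermonde matrix of $\Omega$ is the $m\times N$ matrix $U$ with entries $U_{ij}=x^{\alpha_j}(a_i)$ (the $j$-th monomial evaluated at the point $a_i$). The normalization factors are $r(f)=\int_{[0,1]^n}e^{-f(x)^2}\,dx$ and $\beta=\int_{\mathbb{S}^{N-1}}r(F(y))\,dy$, and $\kappa>0$ is a normalization constant that does not depend on $f$. *)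

theory Defs
  imports "HOL-Analysis.Analysis" "HOL-Library.Poly_Mapping"
begin

text \<open>
  Real polynomials in the variables indexed by the finite type \<open>'n\<close> are the elements of the
  ring \<open>('n \<Rightarrow>\<^sub>0 nat) \<Rightarrow>\<^sub>0 real\<close>: finitely supported maps from exponent vectors to coefficients.
\<close>

type_synonym 'n monomial = "'n \<Rightarrow>\<^sub>0 nat"
type_synonym 'n rpoly = "'n monomial \<Rightarrow>\<^sub>0 real"

definition monomial_degree :: "'n::finite monomial \<Rightarrow> nat" where
  "monomial_degree t = (\<Sum>i\<in>UNIV. Poly_Mapping.lookup t i)"

definition monomial_eval :: "'n::finite monomial \<Rightarrow> real ^ 'n \<Rightarrow> real" where
  "monomial_eval t x = (\<Prod>i\<in>UNIV. (x $ i) ^ Poly_Mapping.lookup t i)"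

text \<open>The zero polynomial is given degree \<open>0\<close>; only bounds \<open>total_degree f \<le> D\<close> are used.\<close>

definition total_degree :: "'n::finite rpoly \<Rightarrow> nat" where
  "total_degree f = Max (insert 0 (monomial_degree ` Poly_Mapping.keys f))"

definition poly_eval :: "'n::finite rpoly \<Rightarrow> real ^ 'n \<Rightarrow> real" where
  "poly_eval f x = (\<Sum>t\<in>Poly_Mapping.keys f. Poly_Mapping.lookup f t * monomial_eval t x)"

text \<open>
  The index set \<open>{1, \<dots>, N}\<close> is a finite linearly ordered type \<open>'k\<close>, whose last index is \<open>Max UNIV\<close>.
\<close>

definition monomial_ordering ::
    "nat \<Rightarrow> ('k::{finite,linorder} \<Rightarrow> 'n::finite monomial) \<Rightarrow> bool" where
  "monomial_ordering D \<alpha> \<longleftrightarrow>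
     bij_betw \<alpha> UNIV {t. monomial_degree t \<le> D} \<and> \<alpha> (Max UNIV) = 0"

definition poly_of_coeffs ::
    "('k::finite \<Rightarrow> 'n::finite monomial) \<Rightarrow> real ^ 'k \<Rightarrow> 'n rpoly" where
  "poly_of_coeffs \<alpha> c = (\<Sum>k\<in>UNIV. Poly_Mapping.single (\<alpha> k) (c $ k))"

definition Theta ::
    "nat \<Rightarrow> ('k::finite \<Rightarrow> 'n::finite monomial) \<Rightarrow> 'n rpoly set" where
  "Theta D \<alpha> = {f. total_degree f \<le> D \<and> norm (inv (poly_of_coeffs \<alpha>) f) = 1}"

definition vandermonde ::
    "('k::finite \<Rightarrow> 'n::finite monomial) \<Rightarrow> ('m::finite \<Rightarrow> real ^ 'n) \<Rightarrow> real ^ 'k ^ 'm" where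
  "vandermonde \<alpha> a = (\<chi> i j. monomial_eval (\<alpha> j) (a i))"

definition unit_cube :: "(real ^ 'n::finite) set" where
  "unit_cube = {x. \<forall>i. 0 \<le> x $ i \<and> x $ i \<le> 1}"

text \<open>
  Surface measure on the unit sphere of a Euclidean space of dimension \<open>d\<close>: the measure of
  \<open>A\<close> is \<open>d\<close> times the Lebesgue measure of the cone \<open>{t *\<^sub>R y | 0 < t < 1, y \<in> A}\<close>
  (integration in polar coordinates).
\<close>

definition sphere_measure :: "'a::euclidean_space measure" where
  "sphere_measure = scale_measure (of_nat DIM('a))
     (distr (restrict_space lborel (ball 0 1 - {0})) (restrict_space borel (sphere 0 1))
        (\<lambda>x. x /\<^sub>R norm x))"

definition r_factor :: "'n::finite rpoly \<Rightarrow> real" where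
  "r_factor f = (LINT x:unit_cube|lborel. exp (- (poly_eval f x)\<^sup>2))"

definition beta_factor :: "('k::finite \<Rightarrow> 'n::finite monomial) \<Rightarrow> real" where
  "beta_factor \<alpha> = (LINT y|sphere_measure. r_factor (poly_of_coeffs \<alpha> y))"

definition likelihood :: "'n::finite rpoly \<Rightarrow> real ^ 'n \<Rightarrow> real" where
  "likelihood f x = 1 / r_factor f * exp (- (poly_eval f x)\<^sup>2)"

definition prior :: "('k::finite \<Rightarrow> 'n::finite monomial) \<Rightarrow> 'n rpoly \<Rightarrow> real" where
  "prior \<alpha> f = 1 / beta_factor \<alpha> * r_factor f"

definition posterior ::
    "real \<Rightarrow> ('k::finite \<Rightarrow> 'n::finite monomial) \<Rightarrow> ('m::finite \<Rightarrow> real ^ 'n) \<Rightarrow> 'n rpoly \<Rightarrow> real" where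
  "posterior \<kappa> \<alpha> a f =
     1 / \<kappa> * (\<Prod>i\<in>UNIV. likelihood f (a i)) * prior \<alpha> f ^ CARD('m)"

definition eigenvalue :: "real ^ 'k ^ 'k::finite \<Rightarrow> real \<Rightarrow> bool" where
  "eigenvalue A \<mu> \<longleftrightarrow> (\<exists>v. v \<noteq> 0 \<and> A *v v = \<mu> *s v)"

definition eigenspace :: "real ^ 'k ^ 'k::finite \<Rightarrow> real \<Rightarrow> (real ^ 'k) set" where
  "eigenspace A \<mu> = {v. A *v v = \<mu> *s v}"

definition smallest_eigenvalue :: "real ^ 'k ^ 'k::finite \<Rightarrow> real" where
  "smallest_eigenvalue A = (LEAST \<mu>. eigenvalue A \<mu>)"

definition argmax_set :: "'a set \<Rightarrow> ('a \<Rightarrow> real) \<Rightarrow> 'a set" where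
  "argmax_set S h = {x. is_arg_max h (\<lambda>y. y \<in> S) x}"

definition argmin_set :: "'a set \<Rightarrow> ('a \<Rightarrow> real) \<Rightarrow> 'a set" where
  "argmin_set S h = {x. is_arg_min h (\<lambda>y. y \<in> S) x}"

end

theory Submission
  imports Defs
begin

text \<open>
  The prior is proportional to \<open>r(f)\<close>, so the factors \<open>r(f)\<close> cancel in the posterior, which becomes a
  positive constant times \<open>exp (- (\<Sum>i. f(a\<^sub>i)\<^sup>2))\<close>. That the constant is positive needs \<open>\<beta> > 0\<close>, which
  holds because \<open>r \<circ> F\<close> is continuous and positive on the sphere. In coefficients the sum of squares
  is the quadratic form of \<open>U\<^sup>tU\<close>, whose minimizers on the unit sphere are the unit eigenvectors for
  the smallest eigenvalue.
\<close>

subsection \<open>Coefficient vectors and polynomials\<close>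

lemma lookup_poly_of_coeffs:
  assumes "inj \<alpha>"
  shows "Poly_Mapping.lookup (poly_of_coeffs \<alpha> c) (\<alpha> k) = c $ k"
proof -
  have "Poly_Mapping.lookup (poly_of_coeffs \<alpha> c) (\<alpha> k) = (\<Sum>j\<in>UNIV. if j = k then c $ j else 0)"
    unfolding poly_of_coeffs_def lookup_sum
    by (intro sum.cong) (auto simp: lookup_single when_def inj_eq[OF assms])
  then show ?thesis by simp
qed

lemma keys_poly_of_coeffs: "Poly_Mapping.keys (poly_of_coeffs \<alpha> c) \<subseteq> range \<alpha>"
proof
  fix t assume "t \<in> Poly_Mapping.keys (poly_of_coeffs \<alpha> c)"
  then have "(\<Sum>k\<in>UNIV. Poly_Mapping.lookup (Poly_Mapping.single (\<alpha> k) (c $ k)) t) \<noteq> 0"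
    by (simp add: in_keys_iff poly_of_coeffs_def lookup_sum)
  then obtain k where "Poly_Mapping.lookup (Poly_Mapping.single (\<alpha> k) (c $ k)) t \<noteq> 0"
    by (meson sum.neutral)
  then show "t \<in> range \<alpha>" by (auto simp: lookup_single when_def split: if_splits)
qed

lemma inj_poly_of_coeffs:
  assumes "inj \<alpha>"
  shows "inj (poly_of_coeffs \<alpha>)"
  by (rule injI) (metis lookup_poly_of_coeffs[OF assms] vec_eq_iff)

lemma poly_eval_poly_of_coeffs:
  assumes "inj \<alpha>"
  shows "poly_eval (poly_of_coeffs \<alpha> c) x = (\<Sum>k\<in>UNIV. c $ k * monomial_eval (\<alpha> k) x)"
proof -
  have "poly_eval (poly_of_coeffs \<alpha> c) x
      = (\<Sum>t\<in>range \<alpha>. Poly_Mapping.lookup (poly_of_coeffs \<alpha> c) t * monomial_eval t x)"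
    unfolding poly_eval_def
    by (intro sum.mono_neutral_left) (use keys_poly_of_coeffs[of \<alpha> c] in \<open>auto simp: in_keys_iff\<close>)
  also have "\<dots> = (\<Sum>k\<in>UNIV. c $ k * monomial_eval (\<alpha> k) x)"
    by (subst sum.reindex[OF assms]) (simp add: lookup_poly_of_coeffs[OF assms])
  finally show ?thesis .
qed

lemma total_degree_le_iff:
  "total_degree f \<le> D \<longleftrightarrow> (\<forall>t\<in>Poly_Mapping.keys f. monomial_degree t \<le> D)"
  by (simp add: total_degree_def)

text \<open>A degree bound confines the support of \<open>f\<close> to
  \<open>range \<alpha>\<close>, so reading off its coefficients there yields a preimage. With
  injectivity this makes \<open>poly_of_coeffs \<alpha>\<close> the isomorphism F.\<close>

lemma range_poly_of_coeffs:
  assumes "bij_betw \<alpha> UNIV {t. monomial_degree t \<le> D}"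
  shows "range (poly_of_coeffs \<alpha>) = {f. total_degree f \<le> D}"
proof (intro equalityI subsetI)
  fix f assume "f \<in> range (poly_of_coeffs \<alpha>)"
  moreover have "range \<alpha> = {t. monomial_degree t \<le> D}"
    using assms by (simp add: bij_betw_def)
  ultimately show "f \<in> {f. total_degree f \<le> D}"
    using keys_poly_of_coeffs[of \<alpha>] by (auto simp: total_degree_le_iff)
next
  have inj: "inj \<alpha>" and range: "range \<alpha> = {t. monomial_degree t \<le> D}"
    using assms by (simp_all add: bij_betw_def)
  fix f :: "'b rpoly" assume "f \<in> {f. total_degree f \<le> D}"
  then have keys: "Poly_Mapping.keys f \<subseteq> range \<alpha>"
    using range by (auto simp: total_degree_le_iff)
  have "f = poly_of_coeffs \<alpha> (\<chi> k. Poly_Mapping.lookup f (\<alpha> k))" (is "_ = ?g")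
  proof (rule poly_mapping_eqI)
    fix t show "Poly_Mapping.lookup f t = Poly_Mapping.lookup ?g t"
    proof (cases "t \<in> range \<alpha>")
      case True
      then show ?thesis by (auto simp: lookup_poly_of_coeffs[OF inj])
    next
      case False
      then have "t \<notin> Poly_Mapping.keys f" "t \<notin> Poly_Mapping.keys ?g"
        using keys keys_poly_of_coeffs by blast+
      then show ?thesis by (simp add: in_keys_iff)
    qed
  qed
  then show "f \<in> range (poly_of_coeffs \<alpha>)" by blast
qed

text \<open>The degree bound places \<open>f\<close> in the range of F, where \<open>inv\<close> is
  a genuine inverse. Optimization can thus move to the compact sphere.\<close>

lemma Theta_eq_image_sphere:
  assumes "bij_betw \<alpha> UNIV {t. monomial_degree t \<le> D}"
  shows "Theta D \<alpha> = poly_of_coeffs \<alpha> ` sphere 0 1"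
proof -
  have inj: "inj (poly_of_coeffs \<alpha>)"
    using assms by (intro inj_poly_of_coeffs) (simp add: bij_betw_def)
  have "Theta D \<alpha> = {f \<in> range (poly_of_coeffs \<alpha>). norm (inv (poly_of_coeffs \<alpha>) f) = 1}"
    by (simp add: Theta_def range_poly_of_coeffs[OF assms])
  also have "\<dots> = poly_of_coeffs \<alpha> ` sphere 0 1"
    by (auto simp: inv_f_f[OF inj])
  finally show ?thesis .
qed

text \<open>The values f(a_i) are the entries of Uc, so both sides equal the squared norm of
  Uc.\<close>

lemma sum_poly_eval_squares_eq_quadratic_form:
  fixes \<alpha> :: "'k::finite \<Rightarrow> 'n::finite monomial" and a :: "'m::finite \<Rightarrow> real ^ 'n"
  assumes "inj \<alpha>"
  shows "(\<Sum>i\<in>UNIV. (poly_eval (poly_of_coeffs \<alpha> c) (a i))\<^sup>2)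
    = c \<bullet> ((transpose (vandermonde \<alpha> a) ** vandermonde \<alpha> a) *v c)"
proof -
  have "poly_eval (poly_of_coeffs \<alpha> c) (a i) = (vandermonde \<alpha> a *v c) $ i" for i
    by (simp add: poly_eval_poly_of_coeffs[OF assms] vandermonde_def matrix_vector_mult_def
        mult.commute)
  then have "(\<Sum>i\<in>UNIV. (poly_eval (poly_of_coeffs \<alpha> c) (a i))\<^sup>2)
      = (vandermonde \<alpha> a *v c) \<bullet> (vandermonde \<alpha> a *v c)"
    by (simp add: inner_vec_def power2_eq_square)
  also have "\<dots> = c \<bullet> ((transpose (vandermonde \<alpha> a) ** vandermonde \<alpha> a) *v c)"
    by (metis dot_lmul_matrix inner_commute matrix_vector_mul_assoc transpose_matrix_vector)
  finally show ?thesis .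
qed

subsection \<open>The normalization factors are positive\<close>

lemma unit_cube_eq_cbox: "unit_cube = cbox 0 1"
  by (auto simp: unit_cube_def mem_box_cart)

lemma content_unit_cube: "measure lborel (cbox 0 1 :: (real ^ 'n::finite) set) = 1"
proof -
  have "cbox 0 1 \<noteq> ({} :: (real ^ 'n) set)" by (auto simp: interval_eq_empty_cart)
  then show ?thesis by (subst content_cbox_cart) auto
qed

text \<open>Joint continuity in \<open>(c, x)\<close> is what continuity of a parameter integral
  requires.\<close>

lemma continuous_on_poly_of_coeffs_eval:
  assumes "inj \<alpha>"
  shows "continuous_on S (\<lambda>(c, x). exp (- (poly_eval (poly_of_coeffs \<alpha> c) x)\<^sup>2))"
  unfolding poly_eval_poly_of_coeffs[OF assms] monomial_eval_def case_prod_beta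
  by (intro continuous_intros)

lemma continuous_on_poly_eval: "continuous_on S (poly_eval f)"
  unfolding poly_eval_def monomial_eval_def by (intro continuous_intros)

lemma r_factor_eq_integral:
  "r_factor f = integral (cbox 0 1) (\<lambda>x. exp (- (poly_eval f x)\<^sup>2))"
  unfolding r_factor_def unit_cube_eq_cbox
  by (intro set_borel_integral_eq_integral borel_integrable_compact[OF compact_cbox, folded set_integrable_def]
      continuous_intros continuous_on_poly_eval)

text \<open>The positive continuous integrand attains a minimum on the compact cube; as the cube has
  volume 1, the integral is at least this minimum.\<close>

lemma r_factor_pos: "r_factor f > 0"
proof -
  let ?h = "\<lambda>x. exp (- (poly_eval f x)\<^sup>2)"
  have cont: "continuous_on (cbox 0 1) ?h"
    by (intro continuous_intros continuous_on_poly_eval)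
  have "cbox 0 1 \<noteq> ({} :: (real ^ 'a) set)" by (auto simp: interval_eq_empty_cart)
  then obtain z where z: "\<And>x. x \<in> cbox 0 1 \<Longrightarrow> ?h z \<le> ?h x"
    using continuous_attains_inf[OF compact_cbox _ cont] by blast
  have "integral (cbox 0 1) (\<lambda>x :: real ^ 'a. ?h z) \<le> integral (cbox 0 1) ?h"
    by (intro integral_le integrable_continuous cont continuous_on_const z)
  then have "?h z \<le> r_factor f"
    by (simp add: r_factor_eq_integral content_unit_cube)
  then show ?thesis by (meson exp_gt_zero less_le_trans)
qed

lemma continuous_on_r_factor:
  assumes "inj \<alpha>"
  shows "continuous_on S (\<lambda>c. r_factor (poly_of_coeffs \<alpha> c))"
  unfolding r_factor_eq_integral
  by (intro integral_continuous_on_param continuous_on_poly_of_coeffs_eval assms)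

section \<open>Total mass of the surface measure: finite and positive\<close>

lemma space_sphere_measure: "space (sphere_measure :: 'a::euclidean_space measure) = sphere 0 1"
  by (simp add: sphere_measure_def space_scale_measure space_restrict_space)

lemma sets_sphere_measure:
  "sets (sphere_measure :: 'a::euclidean_space measure) = sets (restrict_space borel (sphere 0 1))"
  by (simp add: sphere_measure_def)

lemma emeasure_sphere_measure_space:
  "emeasure (sphere_measure :: 'a::euclidean_space measure) (sphere 0 1)
    = of_nat DIM('a) * emeasure lborel (ball 0 1 :: 'a set)"
proof -
  let ?M = "restrict_space lborel (ball 0 1 - {0}) :: 'a measure"
  have "(\<lambda>x. x /\<^sub>R norm x) \<in> ?M \<rightarrow>\<^sub>M restrict_space borel (sphere 0 1)"
    by (intro measurable_restrict_space2 measurable_restrict_space1) (auto simp: space_restrict_space)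
  then have "emeasure (distr ?M (restrict_space borel (sphere 0 1)) (\<lambda>x. x /\<^sub>R norm x)) (sphere 0 1)
      = emeasure ?M ((\<lambda>x. x /\<^sub>R norm x) -` sphere 0 1 \<inter> space ?M)"
    by (rule emeasure_distr)
      (use sets.top[of "restrict_space borel (sphere (0 :: 'a) 1)"] in \<open>simp add: space_restrict_space\<close>)
  \<comment> \<open>Radial projection sends every nonzero point to the sphere, so the preimage is
    the whole punctured ball; the missing origin is a null set.\<close>
  also have "(\<lambda>x. x /\<^sub>R norm x) -` sphere 0 1 \<inter> space ?M = ball 0 1 - {0}"
    by (auto simp: space_restrict_space)
  also have "emeasure ?M (ball 0 1 - {0}) = emeasure lborel (ball 0 1 - {0} :: 'a set)"
    by (simp add: emeasure_restrict_space)
  also have "\<dots> = emeasure lborel (ball 0 1 :: 'a set)"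
    by (rule emeasure_Diff_null_set) auto
  finally show ?thesis
    by (simp add: sphere_measure_def)
qed

lemma finite_measure_sphere_measure: "finite_measure (sphere_measure :: 'a::euclidean_space measure)"
proof (rule finite_measureI)
  have "emeasure lborel (ball 0 1 :: 'a set) < \<infinity>" by (rule emeasure_lborel_ball_finite)
  then show "emeasure (sphere_measure :: 'a measure) (space sphere_measure) \<noteq> \<infinity>"
    unfolding space_sphere_measure emeasure_sphere_measure_space
    by (simp add: ennreal_mult_eq_top_iff less_top)
qed

lemma measure_sphere_measure_pos: "measure (sphere_measure :: 'a::euclidean_space measure) (sphere 0 1) > 0"
proof -
  interpret finite_measure "sphere_measure :: 'a measure" by (rule finite_measure_sphere_measure)
  have "measure lborel (ball 0 1 :: 'a set) > 0" by (rule content_ball_pos) simp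
  then have "emeasure lborel (ball 0 1 :: 'a set) \<noteq> 0"
    by (auto simp: measure_def)
  then have "emeasure (sphere_measure :: 'a measure) (sphere 0 1) \<noteq> 0"
    by (simp add: emeasure_sphere_measure_space)
  then show ?thesis by (simp add: emeasure_eq_measure zero_less_measure_iff)
qed

text \<open>By compactness r(F(c)) has a positive minimum on the sphere, and the integral is at
  least this minimum times the total mass.\<close>

lemma beta_factor_pos:
  fixes \<alpha> :: "'k::finite \<Rightarrow> 'n::finite monomial"
  assumes "inj \<alpha>"
  shows "beta_factor \<alpha> > 0"
proof -
  let ?M = "sphere_measure :: (real ^ 'k) measure"
  let ?g = "\<lambda>c. r_factor (poly_of_coeffs \<alpha> c)"
  interpret finite_measure ?M by (rule finite_measure_sphere_measure)
  have cont: "continuous_on (sphere 0 1) ?g" by (rule continuous_on_r_factor[OF assms])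
  have ne: "sphere 0 1 \<noteq> ({} :: (real ^ 'k) set)" by simp
  obtain z where z: "\<And>c. c \<in> sphere 0 1 \<Longrightarrow> ?g z \<le> ?g c"
    using continuous_attains_inf[OF compact_sphere ne cont] by blast
  \<comment> \<open>The maximum supplies the constant bound for integrability; otherwise the
    integral could be the default value 0.\<close>
  obtain w where w: "\<And>c. c \<in> sphere 0 1 \<Longrightarrow> ?g c \<le> ?g w"
    using continuous_attains_sup[OF compact_sphere ne cont] by blast
  have meas: "?g \<in> borel_measurable ?M"
    using borel_measurable_continuous_on_restrict[OF cont]
    by (simp cong: measurable_cong_sets add: sets_sphere_measure)
  have "norm (?g c) \<le> ?g w" if "c \<in> sphere 0 1" for c
    using w[OF that] r_factor_pos[of "poly_of_coeffs \<alpha> c"] by simp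
  then have "integrable ?M ?g"
    by (intro integrable_const_bound[of _ "?g w"] meas AE_I2) (simp_all add: space_sphere_measure)
  then have "(LINT c|?M. ?g z) \<le> (LINT c|?M. ?g c)"
    by (intro integral_mono) (simp_all add: space_sphere_measure z)
  then have "?g z * measure ?M (sphere 0 1) \<le> beta_factor \<alpha>"
    by (simp add: beta_factor_def space_sphere_measure mult.commute)
  moreover have "?g z * measure ?M (sphere 0 1) > 0"
    by (intro mult_pos_pos r_factor_pos measure_sphere_measure_pos)
  ultimately show ?thesis by linarith
qed

text \<open>The likelihoods contribute one factor 1/r(f) per data point, and the power of the prior
  contributes as many factors r(f).\<close>

lemma posterior_eq_exp:
  fixes a :: "'m::finite \<Rightarrow> real ^ 'n::finite"
  shows "posterior \<kappa> \<alpha> a f =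
    1 / \<kappa> * (1 / beta_factor \<alpha>) ^ CARD('m) * exp (- (\<Sum>i\<in>UNIV. (poly_eval f (a i))\<^sup>2))"
proof -
  have "r_factor f \<noteq> 0" using r_factor_pos[of f] by simp
  have "(\<Prod>i\<in>UNIV. likelihood f (a i))
      = (1 / r_factor f) ^ CARD('m) * exp (- (\<Sum>i\<in>UNIV. (poly_eval f (a i))\<^sup>2))"
    by (simp add: likelihood_def prod.distrib prod_dividef power_one_over exp_sum sum_negf[symmetric])
  then show ?thesis
    using \<open>r_factor f \<noteq> 0\<close> by (simp add: posterior_def prior_def power_divide)
qed

subsection \<open>Minimizing a quadratic form on the unit sphere\<close>

lemma argmin_quadratic_form_sphere:
  fixes A :: "real ^ 'k ^ 'k::finite"
  assumes sym: "transpose A = A"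
  shows "argmin_set (sphere 0 1) (\<lambda>c. c \<bullet> (A *v c))
    = {c \<in> eigenspace A (smallest_eigenvalue A). norm c = 1}"
proof -
  let ?q = "\<lambda>c. c \<bullet> (A *v c)"
  have adj: "x \<bullet> (A *v y) = (A *v x) \<bullet> y" for x y
    by (metis dot_lmul_matrix sym transpose_matrix_vector)
  have "continuous_on (sphere 0 1) ?q"
    by (intro continuous_intros linear_continuous_on) simp
  then obtain z where z: "norm z = 1" "\<And>c. norm c = 1 \<Longrightarrow> ?q z \<le> ?q c"
    using continuous_attains_inf[OF compact_sphere, of "0 :: real ^ 'k" 1 ?q] by auto
  define l where "l = ?q z"
  \<comment> \<open>Both sides are homogeneous of degree 2, so the minimum over unit vectors bounds
    all vectors: the form of A - l is positive semidefinite.\<close>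
  have lower: "l * (v \<bullet> v) \<le> ?q v" for v
  proof (cases "v = 0")
    case False
    then have "l \<le> ?q (v /\<^sub>R norm v)"
      unfolding l_def by (intro z(2)) simp
    also have "\<dots> = ?q v / (v \<bullet> v)"
      by (simp add: matrix_vector_mult_scaleR dot_square_norm power2_eq_square divide_simps)
    finally show ?thesis using False by (simp add: pos_le_divide_eq)
  qed simp
  \<comment> \<open>A null vector of the positive semidefinite form of \<open>A - l\<close> lies in its kernel:
    otherwise moving from \<open>c\<close> against \<open>w\<close> would make the form negative.\<close>
  have kernel: "A *v c = l *\<^sub>R c" if c: "norm c = 1" "?q c = l" for c
  proof (rule ccontr)
    \<comment> \<open>Half the gradient at \<open>c\<close> of the form of A - l.\<close>
    define w where "w = A *v c - l *\<^sub>R c"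
    assume "A *v c \<noteq> l *\<^sub>R c"
    then have p: "w \<bullet> w > 0" by (simp add: w_def)
    define q where "q = ?q w - l * (w \<bullet> w)"
    have q: "q \<ge> 0" using lower[of w] by (simp add: q_def)
    \<comment> \<open>Along c + tw the form of A - l equals 2t(w.w) + t^2 q, least at t = -(w.w)/q
      when q > 0. The denominator q + 1 also covers q = 0 and still makes the value
      negative.\<close>
    define t where "t = - (w \<bullet> w) / (q + 1)"
    have cc: "c \<bullet> c = 1" using c by (simp add: dot_square_norm)
    have "?q (c + t *\<^sub>R w) - l * ((c + t *\<^sub>R w) \<bullet> (c + t *\<^sub>R w))
        = 2 * t * ((A *v c) \<bullet> w - l * (c \<bullet> w)) + t\<^sup>2 * q"
      using c(2) cc adj[of c w]
      by (simp add: matrix_vector_right_distrib matrix_vector_mult_scaleR inner_add q_def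
          power2_eq_square algebra_simps inner_commute)
    also have "(A *v c) \<bullet> w - l * (c \<bullet> w) = w \<bullet> w"
      by (simp add: w_def inner_diff_left)
    also have "w \<bullet> w = - t * (q + 1)" using q by (simp add: t_def)
    also have "2 * t * (- t * (q + 1)) + t\<^sup>2 * q = - (t\<^sup>2 * (q + 2))"
      by (simp add: power2_eq_square algebra_simps)
    also have "\<dots> < 0" using p q by (simp add: t_def)
    finally show False using lower[of "c + t *\<^sub>R w"] by simp
  qed
  \<comment> \<open>The minimizer \<open>z\<close> is an eigenvector for \<open>l\<close>; pairing
    any other eigenvector with itself and applying \<open>lower\<close> shows that its eigenvalue is
    at least \<open>l\<close>.\<close>
  have "smallest_eigenvalue A = l"
    unfolding smallest_eigenvalue_def
  proof (rule Least_equality)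
    have "z \<noteq> 0" using z(1) by auto
    then show "eigenvalue A l"
      using kernel[OF z(1)] by (auto simp: eigenvalue_def l_def scalar_mult_eq_scaleR)
  next
    fix \<mu> assume "eigenvalue A \<mu>"
    then obtain v where v: "v \<noteq> 0" "A *v v = \<mu> *\<^sub>R v"
      by (auto simp: eigenvalue_def scalar_mult_eq_scaleR)
    then show "l \<le> \<mu>" using lower[of v] by simp
  qed
  moreover have "c \<in> argmin_set (sphere 0 1) ?q \<longleftrightarrow> norm c = 1 \<and> ?q c = l" for c
    using z by (force simp: argmin_set_def is_arg_min_def l_def)
  \<comment> \<open>Converse of \<open>kernel\<close>: unit eigenvectors for \<open>l\<close> attain
    the minimum.\<close>
  moreover have "?q c = l" if "norm c = 1" "A *v c = l *\<^sub>R c" for c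
    using that by (simp add: dot_square_norm)
  ultimately show ?thesis
    unfolding set_eq_iff mem_Collect_eq eigenspace_def scalar_mult_eq_scaleR
    using kernel by metis
qed

text \<open>Minimality depends only on the values of the objective, so it transfers along a
  parametrization.\<close>

lemma argmin_set_image: "argmin_set (F ` S) h = F ` argmin_set S (\<lambda>x. h (F x))"
  by (auto simp: argmin_set_def is_arg_min_def)

theorem mainTheorem1:
  fixes D :: nat
    and \<alpha> :: "'k::{finite,linorder} \<Rightarrow> 'n::finite monomial"
    and a :: "'m::finite \<Rightarrow> real ^ 'n"
    and \<kappa> :: real
  assumes D_pos: "D > 0"
    and card_k: "CARD('k) = (CARD('n) + D) choose D"
    and ordering: "monomial_ordering D \<alpha>"
    and points: "\<And>i. a i \<in> unit_cube"
    and kappa_pos: "\<kappa> > 0"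
  shows
    "let F = poly_of_coeffs \<alpha>;
         U = vandermonde \<alpha> a;
         \<mu> = smallest_eigenvalue (transpose U ** U)
     in argmax_set (Theta D \<alpha>) (posterior \<kappa> \<alpha> a)
          = argmin_set (Theta D \<alpha>) (\<lambda>f. \<Sum>i\<in>UNIV. (poly_eval f (a i))\<^sup>2)
      \<and> argmin_set (Theta D \<alpha>) (\<lambda>f. \<Sum>i\<in>UNIV. (poly_eval f (a i))\<^sup>2)
          = F ` argmin_set (sphere 0 1) (\<lambda>c. c \<bullet> ((transpose U ** U) *v c))
      \<and> argmax_set (Theta D \<alpha>) (posterior \<kappa> \<alpha> a)
          = F ` {c \<in> eigenspace (transpose U ** U) \<mu>. norm c = 1}"
proof -
  let ?h = "\<lambda>f. \<Sum>i\<in>UNIV. (poly_eval f (a i))\<^sup>2"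
  let ?A = "transpose (vandermonde \<alpha> a) ** vandermonde \<alpha> a"
  have bij: "bij_betw \<alpha> UNIV {t. monomial_degree t \<le> D}"
    using ordering by (simp add: monomial_ordering_def)
  then have inj: "inj \<alpha>" by (simp add: bij_betw_def)
  have "1 / \<kappa> * (1 / beta_factor \<alpha>) ^ CARD('m) > 0"
    using kappa_pos beta_factor_pos[OF inj] by simp
  \<comment> \<open>The posterior is a strictly decreasing function of the sum of squares, which
    turns maximizers into minimizers.\<close>
  then have "posterior \<kappa> \<alpha> a f < posterior \<kappa> \<alpha> a g \<longleftrightarrow> ?h g < ?h f" for f g
    unfolding posterior_eq_exp by (subst mult_less_cancel_left_pos) auto
  then have argmax: "argmax_set (Theta D \<alpha>) (posterior \<kappa> \<alpha> a) = argmin_set (Theta D \<alpha>) ?h"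
    by (simp add: argmax_set_def argmin_set_def is_arg_max_def is_arg_min_def)
  have argmin: "argmin_set (Theta D \<alpha>) ?h
      = poly_of_coeffs \<alpha> ` argmin_set (sphere 0 1) (\<lambda>c. c \<bullet> (?A *v c))"
    unfolding Theta_eq_image_sphere[OF bij] argmin_set_image
      sum_poly_eval_squares_eq_quadratic_form[OF inj] ..
  have "transpose ?A = ?A"
    by (simp add: matrix_transpose_mul)
  then show ?thesis
    using argmax argmin argmin_quadratic_form_sphere[of ?A] by (simp add: Let_def)
qed

end
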